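(* There exist infinitely many quartic rational Diophantine quadruples; that is, there are infinitely many sets $\{a_1,a_2,a_3,a_4\}\subset\mathbf{Q}$ of four pairwise distinct nonzero rational numbers such that for every $1\le i<j\le 4$ the number $a_ia_j+1$ is a fourth power in $\mathbf{Q}$.
   Context: For integers $k\ge 2$ and $m\ge 2$, a $k$th power rational Diophantine $m$-tuple is a set of $m$ pairwise distinct nonzero rational numbers $\{a_1,\dots,a_m\}\subset\mathbf{Q}$ such that for every $1\le i<j\le m$ the number $a_ia_j+1$ is a $k$th power in $\mathbf{Q}$ (i.e. equal to $q^k$ for some $q\in\mathbf{Q}$; $0=0^k$ counts as a $k$th power). A quartic rational Diophantine quadruple is the case $k=4$, $m=4$. *)

theory Defs
  imports Complex_Main "HOL-Computational_Algebra.Nth_Powers"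
begin

(* Intended for k >= 2 and m >= 2; m > 0 together with card A = m forces A to be finite.
   Since a * b + 1 is symmetric, quantifying over a \<noteq> b in A is the same as over i < j. *)
definition rational_diophantine_tuple :: "nat \<Rightarrow> nat \<Rightarrow> rat set \<Rightarrow> bool" where
  "rational_diophantine_tuple k m A \<longleftrightarrow>
     card A = m \<and> 0 \<notin> A \<and>
     (\<forall>a\<in>A. \<forall>b\<in>A. a \<noteq> b \<longrightarrow> is_nth_power k (a * b + 1))"

abbreviation quartic_rational_diophantine_quadruple :: "rat set \<Rightarrow> bool" where
  "quartic_rational_diophantine_quadruple \<equiv> rational_diophantine_tuple 4 4"

end

(* If p^4 + q^4 = r^4 + s^4, then p^2/q^2, - q^2/p^2, (r^4 - q^4)/(p q)^2 and
   (s^4 - q^4)/(p q)^2 have pairwise products that are one less than 0, (r/q)^4, (s/q)^4,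
   (s/p)^4, (r/p)^4 and (r s/(p q))^4, where the zero counts as a fourth power. Euler's
   solution of this equation, parametrised by x, supplies infinitely many quadruples because
   p/q > x for x >= 4. *)
theory Submission
  imports Defs
begin

lemma quartic_quadruple_of_equal_sums:
  fixes p q r s :: rat
  assumes sums: "p ^ 4 + q ^ 4 = r ^ 4 + s ^ 4"
    and nonzero: "p \<noteq> 0" "q \<noteq> 0" "r \<noteq> 0" "s \<noteq> 0"
    and neq: "r ^ 4 \<noteq> q ^ 4" "s ^ 4 \<noteq> q ^ 4" "r ^ 4 \<noteq> s ^ 4"
  shows "quartic_rational_diophantine_quadruple
    {p\<^sup>2 / q\<^sup>2, - (q\<^sup>2 / p\<^sup>2), (r ^ 4 - q ^ 4) / (p * q)\<^sup>2, (s ^ 4 - q ^ 4) / (p * q)\<^sup>2}"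
proof -
  define a b c d where "a = p\<^sup>2 / q\<^sup>2" and "b = - (q\<^sup>2 / p\<^sup>2)"
    and "c = (r ^ 4 - q ^ 4) / (p * q)\<^sup>2" and "d = (s ^ 4 - q ^ 4) / (p * q)\<^sup>2"
  note defs = a_def b_def c_def d_def
  have p4: "p ^ 4 = r ^ 4 + s ^ 4 - q ^ 4"
    using sums by simp
  \<comment> \<open>Over the common denominator \<open>(p * q)\<^sup>2\<close>, nonvanishing and
    distinctness become linear facts about fourth powers of \<open>p\<close>, \<open>q\<close>,
    \<open>r\<close>, \<open>s\<close>. By \<open>p4\<close>, \<open>a\<close> and \<open>c\<close>
    differ by a multiple of s^4, and \<open>a\<close> and \<open>d\<close> by a multiple of
    r^4.\<close>
  have a': "a = p ^ 4 / (p * q)\<^sup>2" and b': "b = - (q ^ 4) / (p * q)\<^sup>2"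
    using nonzero by (simp_all add: defs power2_eq_square power4_eq_xxxx)
  have pq: "(p * q)\<^sup>2 \<noteq> 0" and pos: "p ^ 4 > 0" "q ^ 4 > 0" "r ^ 4 > 0" "s ^ 4 > 0"
    using nonzero by (simp_all add: zero_less_power_eq)
  have ne: "0 \<notin> {a, b, c, d}"
    using pq nonzero neq by (auto simp: a' b' c_def d_def)
  have "p ^ 4 \<noteq> - (q ^ 4)" "p ^ 4 \<noteq> r ^ 4 - q ^ 4" "p ^ 4 \<noteq> s ^ 4 - q ^ 4"
    "- (q ^ 4) \<noteq> r ^ 4 - q ^ 4" "- (q ^ 4) \<noteq> s ^ 4 - q ^ 4" "r ^ 4 - q ^ 4 \<noteq> s ^ 4 - q ^ 4"
    using pos p4 neq by linarith+
  then have "a \<noteq> b" "a \<noteq> c" "a \<noteq> d" "b \<noteq> c" "b \<noteq> d" "c \<noteq> d"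
    unfolding a' b' c_def d_def divide_cancel_right using pq by auto
  then have card: "card {a, b, c, d} = 4"
    by simp
  have "a * b + 1 = 0 ^ 4"
    using nonzero by (simp add: defs)
  moreover have "a * c + 1 = (r / q) ^ 4" "a * d + 1 = (s / q) ^ 4"
    using nonzero by (simp_all add: defs power2_eq_square power4_eq_xxxx field_simps)
  moreover have "b * c + 1 = (p ^ 4 - (r ^ 4 - q ^ 4)) / p ^ 4"
    "b * d + 1 = (p ^ 4 - (s ^ 4 - q ^ 4)) / p ^ 4"
    using nonzero by (simp_all add: defs power2_eq_square power4_eq_xxxx field_simps)
  then have "b * c + 1 = (s / p) ^ 4" "b * d + 1 = (r / p) ^ 4"
    using sums by (simp_all add: power_divide algebra_simps)
  moreover have "c * d + 1 = ((r ^ 4 - q ^ 4) * (s ^ 4 - q ^ 4) + p ^ 4 * q ^ 4) / (p ^ 4 * q ^ 4)"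
    using nonzero by (simp add: defs power2_eq_square power4_eq_xxxx field_simps)
  then have "c * d + 1 = (r * s / (p * q)) ^ 4"
  proof -
    \<comment> \<open>As r^4 + s^4 = p^4 + q^4, the quadratics (T - r^4)(T - s^4) and (T - p^4)(T -
      q^4) differ by the constant r^4 s^4 - p^4 q^4; evaluate at T = q^4.\<close>
    have "(r ^ 4 - q ^ 4) * (s ^ 4 - q ^ 4) + p ^ 4 * q ^ 4 = r ^ 4 * s ^ 4"
      unfolding p4 by algebra
    with \<open>c * d + 1 = _\<close> show ?thesis
      by (simp add: power_mult_distrib power_divide)
  qed
  ultimately have "is_nth_power 4 (a * b + 1)" "is_nth_power 4 (a * c + 1)"
    "is_nth_power 4 (a * d + 1)" "is_nth_power 4 (b * c + 1)"
    "is_nth_power 4 (b * d + 1)" "is_nth_power 4 (c * d + 1)"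
    by (metis is_nth_powerI)+
  then have "\<forall>x\<in>{a, b, c, d}. \<forall>y\<in>{a, b, c, d}. x \<noteq> y \<longrightarrow> is_nth_power 4 (x * y + 1)"
    by (auto simp: mult.commute)
  with card ne show ?thesis
    unfolding rational_diophantine_tuple_def defs by blast
qed

text \<open>The four bases have the form x u + 3 y, x u - 3 y, w + 3 x^5 and w - 3 x^5 with y = x^2.
  Hence it suffices to compare two differences of the shape (a + b)^4 - (a - b)^4, which
  factor.\<close>

lemma euler_equal_sums_of_fourth_powers:
  fixes x :: "'a :: comm_ring_1"
  shows "(x ^ 7 + x ^ 5 - 2 * x ^ 3 + 3 * x ^ 2 + x) ^ 4
      + (x ^ 6 - 3 * x ^ 5 - 2 * x ^ 4 + x ^ 2 + 1) ^ 4
    = (x ^ 7 + x ^ 5 - 2 * x ^ 3 - 3 * x ^ 2 + x) ^ 4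
      + (x ^ 6 + 3 * x ^ 5 - 2 * x ^ 4 + x ^ 2 + 1) ^ 4"
proof -
  have diff: "(u + v) ^ 4 - (u - v) ^ 4 = 8 * (u * v) * (u\<^sup>2 + v\<^sup>2)" for u v :: 'a
    by (simp add: eval_nat_numeral algebra_simps)
  define y where "y = x\<^sup>2"
  define u where "u = y ^ 3 + y\<^sup>2 - 2 * y + 1"
  define w where "w = y ^ 3 - 2 * y\<^sup>2 + y + 1"
  \<comment> \<open>Since w(y) = y^3 u(1/y), this says that the polynomial u (u^2 + 9 y), of degree
    9 in y, is palindromic.\<close>
  have uw: "u * (u\<^sup>2 + 9 * y) = w * (w\<^sup>2 + 9 * y ^ 5)"
    unfolding u_def w_def by (simp add: eval_nat_numeral algebra_simps)
  have "(x * u + 3 * y) ^ 4 - (x * u - 3 * y) ^ 4 = 24 * x * y\<^sup>2 * (u * (u\<^sup>2 + 9 * y))"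
    unfolding diff by (simp add: y_def power2_eq_square algebra_simps)
  also have "\<dots> = (w + 3 * x ^ 5) ^ 4 - (w - 3 * x ^ 5) ^ 4"
    unfolding diff uw by (simp add: y_def eval_nat_numeral algebra_simps)
  finally have "(x * u + 3 * y) ^ 4 + (w - 3 * x ^ 5) ^ 4 = (x * u - 3 * y) ^ 4 + (w + 3 * x ^ 5) ^ 4"
    by (simp add: algebra_simps)
  moreover have "x * u + 3 * y = x ^ 7 + x ^ 5 - 2 * x ^ 3 + 3 * x\<^sup>2 + x"
    "x * u - 3 * y = x ^ 7 + x ^ 5 - 2 * x ^ 3 - 3 * x\<^sup>2 + x"
    "w - 3 * x ^ 5 = x ^ 6 - 3 * x ^ 5 - 2 * x ^ 4 + x\<^sup>2 + 1"
    "w + 3 * x ^ 5 = x ^ 6 + 3 * x ^ 5 - 2 * x ^ 4 + x\<^sup>2 + 1"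
    unfolding u_def w_def y_def by (simp_all add: eval_nat_numeral algebra_simps)
  ultimately show ?thesis
    by simp
qed

text \<open>Euler's numbers satisfy 0 < q < s < r and p > x q here. The chain excludes the
  degenerate cases, and the last inequality makes the element p^2/q^2 exceed x.\<close>

lemma ex_quartic_quadruple_large_element:
  fixes x :: rat
  assumes "x \<ge> 4"
  obtains A y where "quartic_rational_diophantine_quadruple A" "y \<in> A" "y > x"
proof -
  define p where "p = x ^ 7 + x ^ 5 - 2 * x ^ 3 + 3 * x ^ 2 + x"
  define q where "q = x ^ 6 - 3 * x ^ 5 - 2 * x ^ 4 + x ^ 2 + 1"
  define r where "r = x ^ 7 + x ^ 5 - 2 * x ^ 3 - 3 * x ^ 2 + x"
  define s where "s = x ^ 6 + 3 * x ^ 5 - 2 * x ^ 4 + x ^ 2 + 1"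
  \<comment> \<open>Expanded at x = 4, the polynomials \<open>q\<close>, \<open>r - s\<close> and
    \<open>p - x * q\<close> have only positive coefficients, so they are positive for t \<ge> 0. At
    x = 3, \<open>q\<close> is still negative.\<close>
  define t where "t = x - 4"
  have t: "t \<ge> 0"
    using assms by (simp add: t_def)
  have "q = t ^ 6 + 21 * t ^ 5 + 178 * t ^ 4 + 768 * t ^ 3 + 1729 * t ^ 2 + 1800 * t + 529"
    unfolding q_def t_def by algebra
  then have q: "q > 0"
    using t by (simp add: add_nonneg_pos)
  have "s - q = 6 * x ^ 5"
    by (simp add: s_def q_def)
  moreover have "x ^ 5 > 0"
    using assms by simp
  ultimately have s: "s > q"
    by linarith
  have "r - s = t ^ 7 + 27 * t ^ 6 + 310 * t ^ 5 + 1962 * t ^ 4 + 7390 * t ^ 3 + 16548 * t ^ 2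
      + 20353 * t + 10563"
    unfolding r_def s_def t_def by algebra
  also have "\<dots> > 0"
    using t by (simp add: add_nonneg_pos)
  finally have r: "r > s"
    by simp
  have "p - x * q = 3 * t ^ 6 + 75 * t ^ 5 + 780 * t ^ 4 + 4317 * t ^ 3 + 13407 * t ^ 2
      + 22152 * t + 15216"
    unfolding p_def q_def t_def by algebra
  also have "\<dots> > 0"
    using t by (simp add: add_nonneg_pos)
  finally have "p > x * q"
    by simp
  with q have large: "p / q > x"
    by (simp add: less_divide_eq)
  then have "p / q > 0"
    using assms by simp
  then have "p > 0"
    using q by (simp add: zero_less_divide_iff)
  have "p ^ 4 + q ^ 4 = r ^ 4 + s ^ 4"
    unfolding p_def q_def r_def s_def by (rule euler_equal_sums_of_fourth_powers)
  moreover have "q ^ 4 < s ^ 4" "s ^ 4 < r ^ 4"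
    using q s r by (auto intro: power_strict_mono)
  ultimately have "quartic_rational_diophantine_quadruple
      {p\<^sup>2 / q\<^sup>2, - (q\<^sup>2 / p\<^sup>2), (r ^ 4 - q ^ 4) / (p * q)\<^sup>2, (s ^ 4 - q ^ 4) / (p * q)\<^sup>2}"
    using \<open>p > 0\<close> q r s by (intro quartic_quadruple_of_equal_sums) auto
  moreover have "p\<^sup>2 / q\<^sup>2 > x"
  proof -
    \<comment> \<open>Squaring does not decrease p/q because p/q > x \<ge> 4.\<close>
    have "p / q \<le> (p / q)\<^sup>2"
      using large assms by (intro self_le_power) auto
    with large show ?thesis
      by (simp add: power_divide)
  qed
  ultimately show thesis
    using that by blast
qed

theorem theorem1p2:
  shows "infinite {A :: rat set. quartic_rational_diophantine_quadruple A}"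
proof
  assume fin: "finite {A :: rat set. quartic_rational_diophantine_quadruple A}"
  \<comment> \<open>An infinite set has \<open>card\<close> 0, not 4.\<close>
  have "finite A" if "quartic_rational_diophantine_quadruple A" for A
    using that unfolding rational_diophantine_tuple_def by (metis card.infinite zero_neq_numeral)
  with fin have fin': "finite (\<Union> {A. quartic_rational_diophantine_quadruple A})"
    by blast
  then obtain M where M: "\<And>y. y \<in> \<Union> {A. quartic_rational_diophantine_quadruple A} \<Longrightarrow> y \<le> M"
    by (meson bdd_above.E bdd_above_finite)
  \<comment> \<open>The maximum with 4 meets the hypothesis of the lemma while still exceeding the
    bound \<open>M\<close>.\<close>
  obtain A y where "quartic_rational_diophantine_quadruple A" "y \<in> A" "y > max 4 M"
    by (rule ex_quartic_quadruple_large_element[of "max 4 M"]) auto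
  with M show False
    by fastforce
qed

end
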